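(* Let $L\ge1$ be an integer, and let $P_L$, $Q_L$ be the polynomials defined in the context. Then: (a) The polynomial $P_L$, of degree $L+1$, has $L+1$ distinct real zeros, and the zeros of $P_L$ and $P_{L-1}$ strictly interlace. (b) The polynomial $Q_L$, of degree $L$, has $L$ distinct real zeros, and the zeros of $Q_L$ and $Q_{L-1}$ strictly interlace.
   Context: For integers $L\ge0$ let $$A_L(x)=\frac{d^L}{dx^L}\frac{x}{(x^2+1)^{3/2}},\qquad B_L(x)=\frac{d^L}{dx^L}\frac{1}{(x^2+1)^{3/2}},$$ where the $0$th derivative is the function itself. Then $P_L(x)=(1+x^2)^{(2L+3)/2}A_L(x)$ and $Q_L(x)=(1+x^2)^{(2L+3)/2}B_L(x)$ are polynomials of degree $L+1$ and $L$, respectively; they satisfy $P_0(x)=x$, $Q_0(x)=1$, $P_L=(1+x^2)P_{L-1}'-(2L+1)xP_{L-1}$, $Q_L=(1+x^2)Q_{L-1}'-(2L+1)xQ_{L-1}$ for $L\ge1$. For a polynomial $p$ with only distinct real zeros and a polynomial $q$ of smaller degree, the zeros of $p$ and $q$ strictly interlace if $p$ and $q$ have no common zero and there is exactly one zero of $q$ strictly between any two consecutive zeros of $p$. *)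

theory Defs
  imports "HOL-Analysis.Analysis" "HOL-Computational_Algebra.Polynomial"
begin

definition A_fun :: "nat \<Rightarrow> real \<Rightarrow> real" where
  "A_fun L = (deriv ^^ L) (\<lambda>x. x / (x\<^sup>2 + 1) powr (3/2))"

definition B_fun :: "nat \<Rightarrow> real \<Rightarrow> real" where
  "B_fun L = (deriv ^^ L) (\<lambda>x. 1 / (x\<^sup>2 + 1) powr (3/2))"

text \<open>
  That the functions on the right-hand sides are indeed polynomial functions is shown in
  \<open>poly_P_poly\<close> and \<open>poly_Q_poly\<close> below, so that the definite descriptions are well-defined.
\<close>

definition P_poly :: "nat \<Rightarrow> real poly" where
  "P_poly L = (THE p. \<forall>x. poly p x = (1 + x\<^sup>2) powr (real (2 * L + 3) / 2) * A_fun L x)"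

definition Q_poly :: "nat \<Rightarrow> real poly" where
  "Q_poly L = (THE p. \<forall>x. poly p x = (1 + x\<^sup>2) powr (real (2 * L + 3) / 2) * B_fun L x)"

text \<open>All complex zeros of the real polynomial are real, and they are simple.\<close>

definition only_distinct_real_zeros :: "real poly \<Rightarrow> bool" where
  "only_distinct_real_zeros p \<longleftrightarrow>
     rsquarefree (map_poly complex_of_real p) \<and>
     (\<forall>z. poly (map_poly complex_of_real p) z = 0 \<longrightarrow> z \<in> \<real>)"

definition consecutive_zeros :: "real poly \<Rightarrow> real \<Rightarrow> real \<Rightarrow> bool" where
  "consecutive_zeros p a b \<longleftrightarrow>
     a < b \<and> poly p a = 0 \<and> poly p b = 0 \<and> (\<forall>x. a < x \<and> x < b \<longrightarrow> poly p x \<noteq> 0)"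

text \<open>
  The first two conjuncts are the standing requirements under which the notion is used. Given the
  first one, it suffices to exclude real common zeros.
\<close>

definition zeros_strictly_interlace :: "real poly \<Rightarrow> real poly \<Rightarrow> bool" where
  "zeros_strictly_interlace p q \<longleftrightarrow>
     only_distinct_real_zeros p \<and> degree q < degree p \<and>
     (\<nexists>x. poly p x = 0 \<and> poly q x = 0) \<and>
     (\<forall>a b. consecutive_zeros p a b \<longrightarrow> (\<exists>!c. a < c \<and> c < b \<and> poly q c = 0))"

lemma iterated_deriv_poly_div_powr:
  fixes p :: "real poly"
  shows "\<exists>r. (deriv ^^ L) (\<lambda>x. poly p x / (x\<^sup>2 + 1) powr (3/2)) =
             (\<lambda>x. poly r x * (x\<^sup>2 + 1) powr (- real (2 * L + 3) / 2))"
proof (induction L)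
  case 0
  show ?case
    by (rule exI[of _ p]) (simp add: powr_minus_divide)
next
  case (Suc L)
  then obtain r where r: "(deriv ^^ L) (\<lambda>x. poly p x / (x\<^sup>2 + 1) powr (3/2)) =
      (\<lambda>x. poly r x * (x\<^sup>2 + 1) powr (- real (2 * L + 3) / 2))"
    by blast
  define s where "s = [:1, 0, 1:] * pderiv r - smult (real (2 * L + 3)) ([:0, 1:] * r)"
  have "deriv (\<lambda>x. poly r x * (x\<^sup>2 + 1) powr (- real (2 * L + 3) / 2)) x =
        poly s x * (x\<^sup>2 + 1) powr (- real (2 * Suc L + 3) / 2)" for x
  proof (rule DERIV_imp_deriv)
    define e where "e = - real (2 * L + 3) / 2"
    have pos: "x\<^sup>2 + 1 > 0"
      by (simp add: add_nonneg_pos)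
    have e': "- real (2 * Suc L + 3) / 2 = e - 1"
      by (simp add: e_def field_simps)
    have split: "(x\<^sup>2 + 1) powr e = (x\<^sup>2 + 1) * (x\<^sup>2 + 1) powr (e - 1)"
      using pos by (simp add: powr_diff)
    have D: "((\<lambda>x. (x\<^sup>2 + 1) powr e) has_real_derivative
           e * (x\<^sup>2 + 1) powr (e - 1) * (2 * x)) (at x)"
      using pos by (auto intro!: derivative_eq_intros)
    have "((\<lambda>x. poly r x * (x\<^sup>2 + 1) powr e) has_real_derivative
           poly (pderiv r) x * (x\<^sup>2 + 1) powr e +
           e * (x\<^sup>2 + 1) powr (e - 1) * (2 * x) * poly r x) (at x)"
      by (rule DERIV_mult[OF poly_DERIV D])
    also have "poly (pderiv r) x * (x\<^sup>2 + 1) powr e +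
           e * (x\<^sup>2 + 1) powr (e - 1) * (2 * x) * poly r x =
           poly s x * (x\<^sup>2 + 1) powr (e - 1)"
      unfolding split s_def by (simp add: e_def field_simps power2_eq_square)
    finally show "((\<lambda>x. poly r x * (x\<^sup>2 + 1) powr (- real (2 * L + 3) / 2))
        has_real_derivative poly s x * (x\<^sup>2 + 1) powr (- real (2 * Suc L + 3) / 2)) (at x)"
      unfolding e' by (simp only: e_def)
  qed
  then show ?case
    using r by auto
qed

lemma ex1_poly_powr_mult_iterated_deriv:
  fixes p :: "real poly"
  shows "\<exists>!r. \<forall>x. poly r x = (1 + x\<^sup>2) powr (real (2 * L + 3) / 2) *
           (deriv ^^ L) (\<lambda>x. poly p x / (x\<^sup>2 + 1) powr (3/2)) x"
proof -
  obtain r where r: "(deriv ^^ L) (\<lambda>x. poly p x / (x\<^sup>2 + 1) powr (3/2)) =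
      (\<lambda>x. poly r x * (x\<^sup>2 + 1) powr (- real (2 * L + 3) / 2))"
    using iterated_deriv_poly_div_powr by blast
  have "(1 + x\<^sup>2) powr (real (2 * L + 3) / 2) *
      (poly r x * (x\<^sup>2 + 1) powr (- real (2 * L + 3) / 2)) = poly r x" for x
  proof -
    have "1 + x\<^sup>2 \<noteq> 0"
      by (metis add_pos_nonneg less_irrefl zero_le_power2 zero_less_one)
    then have "(1 + x\<^sup>2) powr (real (2 * L + 3) / 2) * (1 + x\<^sup>2) powr (- real (2 * L + 3) / 2) = 1"
      by (simp add: minus_divide_left[symmetric] powr_minus del: of_nat_add of_nat_mult)
    then show ?thesis
      by (simp only: add.commute[of "x\<^sup>2"] mult.left_commute mult_1_right)
  qed
  then show ?thesis
    unfolding r by (intro ex1I[of _ r]) (auto simp: poly_eq_poly_eq_iff[symmetric])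
qed

lemma poly_P_poly: "poly (P_poly L) x = (1 + x\<^sup>2) powr (real (2 * L + 3) / 2) * A_fun L x"
  using theI'[OF ex1_poly_powr_mult_iterated_deriv[of L "[:0, 1:]"]]
  by (simp add: P_poly_def A_fun_def)

lemma poly_Q_poly: "poly (Q_poly L) x = (1 + x\<^sup>2) powr (real (2 * L + 3) / 2) * B_fun L x"
  using theI'[OF ex1_poly_powr_mult_iterated_deriv[of L "[:1:]"]]
  by (simp add: Q_poly_def B_fun_def)

end

theory Submission
  imports Defs
begin

text \<open>
  Both families obey the recursion \<open>R (Suc L) = T (R L)\<close> with
  \<open>T p = (1 + x\<^sup>2) p' - k x p\<close> and \<open>k = 2 L + 3\<close>. The operator \<open>T\<close> becomes a plain derivative
  under the substitution \<open>x = tan t\<close>: since \<open>dx/dt = 1 + x\<^sup>2\<close>, the function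
  \<open>g t = cos t ^ k * p (tan t)\<close> on \<open>(-\<pi>/2, \<pi>/2)\<close> satisfies \<open>g' t = cos t ^ k * (T p) (tan t)\<close>.
  If \<open>degree p < k\<close>, then \<open>g\<close> extends to a trigonometric polynomial vanishing at
  \<open>\<plusminus>\<pi>/2\<close>, so the two points at infinity count as additional zeros. When \<open>p\<close> has \<open>n = degree p\<close>
  distinct real zeros, \<open>g\<close> thus has \<open>n + 2\<close> zeros in \<open>[-\<pi>/2, \<pi>/2]\<close>, and Rolle's theorem
  (\<open>Rolle_circle_form\<close>) puts a zero of \<open>T p\<close> into each of the \<open>n + 1\<close> gaps between them.

  As \<open>T p\<close> has degree \<open>n + 1\<close>, these are all its zeros, complex ones included, they are simple, and
  each gap contains exactly one of them. Two zeros of \<open>T p\<close> therefore lie in different gaps and are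
  separated by a zero of \<open>p\<close>. Two zeros of \<open>p\<close> between consecutive zeros of \<open>T p\<close> are impossible,
  again by Rolle. This is \<open>angular_deriv_interlaces\<close>, whose conclusion reproduces its hypothesis
  on \<open>p\<close>, so that it iterates. The degrees \<open>L + 1\<close> and \<open>L\<close> of the two families stay below
  \<open>2 L + 3\<close>.
\<close>

section \<open>The recursion operator as a derivative with respect to the angle\<close>

definition angular_deriv :: "nat \<Rightarrow> real poly \<Rightarrow> real poly" where
  "angular_deriv k p = [:1, 0, 1:] * pderiv p - smult (real k) (pCons 0 p)"

lemma poly_angular_deriv:
  "poly (angular_deriv k p) x = (1 + x\<^sup>2) * poly (pderiv p) x - real k * x * poly p x"
  by (simp add: angular_deriv_def power2_eq_square algebra_simps)

lemma degree_angular_deriv: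
  assumes "p \<noteq> 0" "degree p < k"
  shows "degree (angular_deriv k p) = degree p + 1"
proof (rule antisym)
  have "degree ([:1, 0, 1:] * pderiv p) \<le> degree p + 1"
  proof (cases "pderiv p = 0")
    case False
    then have "degree p \<noteq> 0"
      by (simp add: pderiv_eq_0_iff)
    then show ?thesis
      using degree_mult_le[of "[:1, 0, 1:]" "pderiv p"] by (simp add: degree_pderiv)
  qed simp
  moreover have "degree (smult (real k) (pCons 0 p)) \<le> degree p + 1"
    using assms by (simp add: degree_pCons_eq)
  ultimately show "degree (angular_deriv k p) \<le> degree p + 1"
    unfolding angular_deriv_def by (rule degree_diff_le)
next
  \<comment> \<open>The leading coefficient gets multiplied by \<open>degree p - k\<close>, which is nonzero.\<close>
  have "coeff (angular_deriv k p) (degree p + 1) = (real (degree p) - real k) * lead_coeff p"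
    by (cases "degree p")
      (simp_all add: angular_deriv_def coeff_pderiv coeff_eq_0 algebra_simps)
  then show "degree p + 1 \<le> degree (angular_deriv k p)"
    using assms by (intro le_degree) auto
qed

text \<open>
  The homogenization \<open>\<Sum>i. coeff p i * X\<^sup>i * Y ^ (k - i)\<close> of \<open>p\<close> in degree \<open>k\<close>, restricted to the circle
  \<open>X = sin t\<close>, \<open>Y = cos t\<close>. Unlike \<open>cos t ^ k * poly p (tan t)\<close>, it is continuous
  at \<open>\<plusminus>\<pi>/2\<close>, too.
\<close>
definition circle_form :: "nat \<Rightarrow> real poly \<Rightarrow> real \<Rightarrow> real" where
  "circle_form k p t = (\<Sum>i\<le>degree p. coeff p i * sin t ^ i * cos t ^ (k - i))"

lemma circle_form_eq:
  assumes "degree p \<le> k" "cos t \<noteq> 0"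
  shows "circle_form k p t = cos t ^ k * poly p (tan t)"
proof -
  have "coeff p i * sin t ^ i * cos t ^ (k - i) = cos t ^ k * (coeff p i * tan t ^ i)"
    if "i \<le> degree p" for i
  proof -
    have "cos t ^ k = cos t ^ i * cos t ^ (k - i)"
      using that assms(1) by (simp flip: power_add)
    then show ?thesis
      using assms(2) by (simp add: tan_def power_divide)
  qed
  then show ?thesis
    unfolding circle_form_def poly_altdef sum_distrib_left by (intro sum.cong) auto
qed

text \<open>
  Every term of the sum keeps a positive power of the cosine: in degree \<open>k > degree p\<close> the homogenization
  of \<open>p\<close> has a zero at infinity.
\<close>
lemma circle_form_eq_0:
  assumes "degree p < k" "cos t = 0"
  shows "circle_form k p t = 0"
  using assms by (auto simp: circle_form_def intro!: sum.neutral)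

text \<open>
  The derivative of the tangent contributes the factor \<open>1 + x\<^sup>2\<close>, and that of \<open>cos t ^ k\<close> contributes
  \<open>- k tan t\<close>.
\<close>
lemma DERIV_circle_form:
  assumes "degree p < k" "cos t \<noteq> 0"
  shows "(circle_form k p has_real_derivative cos t ^ k * poly (angular_deriv k p) (tan t)) (at t)"
proof -
  have k: "cos t ^ k = cos t * cos t ^ (k - 1)"
    using assms(1) by (simp flip: power_Suc)
  have sec: "inverse ((cos t)\<^sup>2) = 1 + (tan t)\<^sup>2"
    using tan_sec[OF assms(2)] by (simp add: power_inverse)
  have "((\<lambda>t. cos t ^ k * poly p (tan t)) has_real_derivative
      cos t ^ k * (poly (pderiv p) (tan t) * inverse ((cos t)\<^sup>2)) +
      (real k * (cos t ^ (k - 1) * - sin t)) * poly p (tan t)) (at t)"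
    using assms(2)
    by (auto intro!: derivative_eq_intros DERIV_chain2[OF poly_DERIV DERIV_tan])
  also have "cos t ^ k * (poly (pderiv p) (tan t) * inverse ((cos t)\<^sup>2)) +
      (real k * (cos t ^ (k - 1) * - sin t)) * poly p (tan t) =
      cos t ^ k * poly (angular_deriv k p) (tan t)"
  proof -
    have "sin t = tan t * cos t"
      using assms(2) by (simp add: tan_def)
    then show ?thesis
      unfolding poly_angular_deriv sec k by (simp add: algebra_simps)
  qed
  finally show ?thesis
  proof (rule has_field_derivative_transform_within_open[where S = "{t. cos t \<noteq> 0}"])
    show "open {t::real. cos t \<noteq> 0}"
      by (intro open_Collect_neq continuous_intros)
  qed (use assms in \<open>auto simp: circle_form_eq\<close>)
qed

text \<open>
  The endpoints may be \<open>\<plusminus>\<pi>/2\<close>, which is how zeros of \<open>angular_deriv k p\<close> beyond the extreme zeros of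
  \<open>p\<close> are found.
\<close>
lemma Rolle_circle_form:
  assumes "degree p < k" "- (pi / 2) \<le> u" "u < v" "v \<le> pi / 2"
    and "circle_form k p u = 0" "circle_form k p v = 0"
  shows "\<exists>t. u < t \<and> t < v \<and> poly (angular_deriv k p) (tan t) = 0"
proof -
  have cos: "cos t > 0" if "u < t" "t < v" for t
    using that assms by (intro cos_gt_zero_pi) auto
  have "\<exists>t>u. t < v \<and> (circle_form k p has_real_derivative 0) (at t)"
  proof (rule Rolle)
    show "continuous_on {u..v} (circle_form k p)"
      unfolding circle_form_def by (intro continuous_intros)
    show "circle_form k p differentiable at t" if "u < t" "t < v" for t
      using DERIV_circle_form[OF assms(1), of t] cos[OF that]
      by (auto simp: real_differentiable_def)
  qed (use assms in auto)
  then obtain t where t: "u < t" "t < v" "(circle_form k p has_real_derivative 0) (at t)"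
    by blast
  then have "cos t ^ k * poly (angular_deriv k p) (tan t) = 0"
    using DERIV_circle_form[OF assms(1), of t] cos[OF t(1,2)] DERIV_unique by fastforce
  then show ?thesis
    using t cos[OF t(1,2)] by auto
qed

lemma zero_between_zeros:
  assumes "degree p < k" "a < b" "poly p a = 0" "poly p b = 0"
  shows "\<exists>c. a < c \<and> c < b \<and> poly (angular_deriv k p) c = 0"
proof -
  have "\<exists>t. arctan a < t \<and> t < arctan b \<and> poly (angular_deriv k p) (tan t) = 0"
    using assms arctan_bounded[of a] arctan_bounded[of b]
    by (intro Rolle_circle_form) (auto simp: circle_form_eq arctan_less_iff tan_arctan)
  then obtain t where t: "arctan a < t" "t < arctan b" "poly (angular_deriv k p) (tan t) = 0"
    by blast
  moreover have "arctan (tan t) = t"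
    using t(1,2) arctan_lbound[of a] arctan_ubound[of b] by (intro arctan_tan) auto
  ultimately show ?thesis
    by (metis arctan_less_iff)
qed

section \<open>Interlacing\<close>

text \<open>
  The zero polynomial has to be excluded explicitly, because its zero set is infinite and so has \<open>card\<close> 0,
  which is also its degree.
\<close>
definition splits_simply :: "real poly \<Rightarrow> bool" where
  "splits_simply p \<longleftrightarrow> p \<noteq> 0 \<and> card {x. poly p x = 0} = degree p"

text \<open>
  The real zeros already exhaust the number of zeros that the degree allows over the complex numbers. As
  the orders of all zeros sum up to at most the degree, each order is 1.
\<close>
lemma splits_simply_imp_only_distinct_real_zeros:
  assumes "splits_simply p"
  shows "only_distinct_real_zeros p"
proof -
  define pc where "pc = map_poly complex_of_real p"
  have p: "p \<noteq> 0" and card: "card {x. poly p x = 0} = degree p"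
    using assms by (auto simp: splits_simply_def)
  have pc: "pc \<noteq> 0" "degree pc = degree p"
    using p by (auto simp: pc_def map_poly_eq_0_iff degree_map_poly)
  have eval: "poly pc (of_real x) = of_real (poly p x)" for x
    unfolding pc_def by (simp add: poly_altdef degree_map_poly coeff_map_poly)
  have sub: "of_real ` {x. poly p x = 0} \<subseteq> {z. poly pc z = 0}"
    using eval by auto
  have fin: "finite {z. poly pc z = 0}"
    by (rule poly_roots_finite[OF pc(1)])
  have card': "card (complex_of_real ` {x. poly p x = 0}) = degree p"
    using card by (simp add: card_image inj_on_def)
  have le: "card {z. poly pc z = 0} \<le> degree p"
    using card_poly_roots_bound[OF pc(1)] pc(2) by simp
  have eq: "of_real ` {x. poly p x = 0} = {z. poly pc z = 0}"
    using card_seteq[OF fin sub] card' le by simp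
  have "order z pc = 1" if z: "poly pc z = 0" for z
  proof (rule antisym)
    let ?R = "{z. poly pc z = 0}"
    have ge: "1 \<le> order w pc" if "w \<in> ?R" for w
      using that pc(1) by (simp add: order_root Suc_leI)
    have "card (?R - {z}) \<le> (\<Sum>w\<in>?R - {z}. order w pc)"
      using sum_mono[of "?R - {z}" "\<lambda>_. 1" "\<lambda>w. order w pc"] ge by simp
    moreover have "(\<Sum>w\<in>?R. order w pc) = order z pc + (\<Sum>w\<in>?R - {z}. order w pc)"
      using fin z by (intro sum.remove) auto
    moreover have "(\<Sum>w\<in>?R. order w pc) \<le> card ?R"
      using sum_order_le_degree[OF pc(1)] card' eq pc(2) by simp
    moreover have "card ?R = Suc (card (?R - {z}))"
      using fin z by (intro card.remove) auto
    ultimately show "order z pc \<le> 1"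
      by linarith
    show "1 \<le> order z pc"
      using ge z by simp
  qed
  then have "rsquarefree pc"
    using pc(1) by (auto simp: rsquarefree_def order_root)
  moreover have "z \<in> \<real>" if "poly pc z = 0" for z
    using that eq by (auto simp: Reals_def)
  ultimately show ?thesis
    by (simp add: only_distinct_real_zeros_def pc_def)
qed

text \<open>
  The zeros of \<open>p\<close> are treated as angles, together with \<open>-\<pi>/2\<close>; call this set \<open>S\<close>. Choosing for each
  \<open>s \<in> S\<close> a zero \<open>f s\<close> of \<open>q\<close> in the gap that starts at \<open>s\<close> gives a strictly increasing
  map, and comparing the size of \<open>S\<close> with the degree of \<open>q\<close> shows that it reaches all zeros of \<open>q\<close>.
  So every zero of \<open>q\<close> comes with the left end of its gap, which separates it from all smaller
  zeros of \<open>q\<close>.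
\<close>
theorem angular_deriv_interlaces:
  assumes "splits_simply p" "degree p < k"
  defines "q \<equiv> angular_deriv k p"
  shows "splits_simply q" "zeros_strictly_interlace q p"
proof -
  have p: "p \<noteq> 0" and card_p: "card {x. poly p x = 0} = degree p"
    using assms by (auto simp: splits_simply_def)
  have deg_q: "degree q = degree p + 1"
    unfolding q_def by (rule degree_angular_deriv[OF p assms(2)])
  then have q: "q \<noteq> 0"
    by auto
  define Z where "Z = arctan ` {x. poly p x = 0}"
  define S where "S = insert (- (pi / 2)) Z"
  have fin_Z: "finite Z"
    using poly_roots_finite[OF p] by (simp add: Z_def)
  have Z_bounds: "- (pi / 2) < z \<and> z < pi / 2" if "z \<in> Z" for z
    using that arctan_bounded by (auto simp: Z_def)
  have card_S: "card S = degree p + 1"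
  proof -
    have "card Z = degree p"
      using card_p by (simp add: Z_def card_image inj_on_def arctan_eq_iff)
    then show ?thesis
      using fin_Z Z_bounds by (force simp: S_def)
  qed
  have form_zero: "circle_form k p s = 0" if "s \<in> S \<or> s = pi / 2" for s
  proof (cases "s \<in> Z")
    case True
    then show ?thesis
      using assms(2) by (auto simp: Z_def circle_form_eq tan_arctan)
  next
    case False
    then have "s = - (pi / 2) \<or> s = pi / 2"
      using that by (auto simp: S_def)
    then have "cos s = 0"
      by (metis cos_minus cos_pi_half)
    then show ?thesis
      using assms(2) by (rule circle_form_eq_0[rotated])
  qed
  have ex: "\<exists>t. s < t \<and> t < pi / 2 \<and> (\<forall>z\<in>Z. s < z \<longrightarrow> t < z) \<and> poly q (tan t) = 0"
    if "s \<in> S" for s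
  proof -
    \<comment> \<open>The gap to the right of \<open>s\<close> ends at the next zero of \<open>p\<close>, or at infinity if there is none.\<close>
    define N where "N = insert (pi / 2) {z \<in> Z. s < z}"
    have N: "finite N" "N \<noteq> {}"
      using fin_Z by (auto simp: N_def)
    have "Min N \<in> N"
      using N by (rule Min_in)
    moreover have "s < pi / 2"
      using that Z_bounds by (auto simp: S_def)
    ultimately have "s < Min N" "Min N \<in> S \<or> Min N = pi / 2"
      unfolding N_def S_def by force+
    then have "s < Min N" "circle_form k p (Min N) = 0"
      using form_zero by auto
    moreover have "Min N \<le> pi / 2" "\<forall>z\<in>Z. s < z \<longrightarrow> Min N \<le> z"
      using Min_le[OF N(1)] unfolding N_def by blast+
    moreover have "- (pi / 2) \<le> s"
      using that Z_bounds by (force simp: S_def)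
    moreover have "circle_form k p s = 0"
      using form_zero that by blast
    ultimately have "\<exists>t. s < t \<and> t < Min N \<and> poly q (tan t) = 0"
      unfolding q_def by (intro Rolle_circle_form[OF assms(2)])
    then show ?thesis
      using \<open>Min N \<le> pi / 2\<close> \<open>\<forall>z\<in>Z. s < z \<longrightarrow> Min N \<le> z\<close> by (meson less_le_trans)
  qed
  then obtain f where f: "\<And>s. s \<in> S \<Longrightarrow> s < f s" "\<And>s. s \<in> S \<Longrightarrow> f s < pi / 2"
    "\<And>s z. s \<in> S \<Longrightarrow> z \<in> Z \<Longrightarrow> s < z \<Longrightarrow> f s < z" "\<And>s. s \<in> S \<Longrightarrow> poly q (tan (f s)) = 0"
    by metis
  have gap: "f s < s'" "s' \<in> Z" if "s \<in> S" "s' \<in> S" "s < s'" for s s'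
  proof -
    show "s' \<in> Z"
      using that Z_bounds by (force simp: S_def)
    then show "f s < s'"
      using that f(3) by auto
  qed
  have f_mono: "f s < f s'" if "s \<in> S" "s' \<in> S" "s < s'" for s s'
    using gap[OF that] f(1)[OF that(2)] by simp
  have arctan_tan_f: "arctan (tan (f s)) = f s" if "s \<in> S" for s
  proof (rule arctan_tan)
    have "- (pi / 2) \<le> s"
      using that Z_bounds by (force simp: S_def)
    then show "- (pi / 2) < f s"
      using f(1)[OF that] by simp
  qed (use that f(2) in auto)
  have inj: "inj_on (\<lambda>s. tan (f s)) S"
    by (rule inj_onI) (metis arctan_tan_f f_mono less_irrefl linorder_neqE_linordered_idom)
  have fin_q: "finite {x. poly q x = 0}"
    by (rule poly_roots_finite[OF q])
  have card_image_S: "card ((\<lambda>s. tan (f s)) ` S) = degree q"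
    using card_image[OF inj] card_S deg_q by simp
  \<comment> \<open>The values of \<open>f\<close> are already as many as \<open>q\<close> can have zeros.\<close>
  have zeros_q: "(\<lambda>s. tan (f s)) ` S = {x. poly q x = 0}"
    using card_poly_roots_bound[OF q] f(4) card_image_S
    by (intro card_seteq[OF fin_q]) auto
  show splits: "splits_simply q"
    using zeros_q card_image_S q by (simp add: splits_simply_def)
  have angle: "\<exists>s\<in>S. arctan x = f s" if "poly q x = 0" for x
  proof -
    have "x \<in> (\<lambda>s. tan (f s)) ` S"
      using that zeros_q by blast
    then show ?thesis
      using arctan_tan_f by auto
  qed
  have no_common: "poly p x \<noteq> 0" if "poly q x = 0" for x
  proof
    assume "poly p x = 0"
    then have "arctan x \<in> Z"
      by (simp add: Z_def)
    then show False
      using angle[OF that] f(1,3) by (metis less_irrefl)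
  qed
  have "\<exists>!c. a < c \<and> c < b \<and> poly p c = 0" if "consecutive_zeros q a b" for a b
  proof -
    have ab: "a < b" "poly q a = 0" "poly q b = 0"
      and none: "\<And>x. a < x \<Longrightarrow> x < b \<Longrightarrow> poly q x \<noteq> 0"
      using that by (auto simp: consecutive_zeros_def)
    obtain s s' where s: "s \<in> S" "s' \<in> S" "arctan a = f s" "arctan b = f s'"
      using angle ab by meson
    have "f s < f s'"
      using ab(1) s by (metis arctan_less_iff)
    then have "s < s'"
      using f_mono[of s' s] s by (metis less_asym' linorder_neqE_linordered_idom)
    \<comment> \<open>The left end of the gap of \<open>b\<close> is the zero of \<open>p\<close> that is wanted.\<close>
    then have "arctan a < s'" "s' < arctan b" "s' \<in> Z"
      using gap[of s s'] f(1)[of s'] s by auto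
    then obtain c where c: "a < c" "c < b" "poly p c = 0"
      by (auto simp: Z_def arctan_less_iff)
    moreover have "c' = c" if "a < c'" "c' < b" "poly p c' = 0" for c'
    proof (rule ccontr)
      assume "c' \<noteq> c"
      \<comment> \<open>Rolle would give a zero of \<open>q\<close> between the two, against consecutiveness of \<open>a\<close> and \<open>b\<close>.\<close>
      then have "\<exists>x. min c c' < x \<and> x < max c c' \<and> poly q x = 0"
        unfolding q_def using c that
        by (intro zero_between_zeros assms) (auto simp: min_def max_def)
      then show False
        using none c that by (auto simp: min_def max_def split: if_splits)
    qed
    ultimately show ?thesis
      by blast
  qed
  then show "zeros_strictly_interlace q p"
    using splits_simply_imp_only_distinct_real_zeros[OF splits] deg_q no_common
    by (auto simp: zeros_strictly_interlace_def)
qed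

section \<open>The two families of polynomials\<close>
lemma deriv_poly_times_powr:
  assumes "\<And>x. F x = poly p x * (1 + x\<^sup>2) powr (- real k / 2)"
  shows "deriv F x = poly (angular_deriv k p) x * (1 + x\<^sup>2) powr (- real (k + 2) / 2)"
proof (rule DERIV_imp_deriv)
  define e where "e = - real k / 2"
  have pos: "1 + x\<^sup>2 > 0"
    by (simp add: add_pos_nonneg)
  have split: "(1 + x\<^sup>2) powr e = (1 + x\<^sup>2) * (1 + x\<^sup>2) powr (e - 1)"
    using pos by (simp add: powr_diff)
  have F: "F = (\<lambda>x. poly p x * (1 + x\<^sup>2) powr e)"
    by (simp add: assms e_def fun_eq_iff)
  have e': "- real (k + 2) / 2 = e - 1"
    by (simp add: e_def field_simps)
  have "((\<lambda>x. (1 + x\<^sup>2) powr e) has_real_derivative e * (1 + x\<^sup>2) powr (e - 1) * (2 * x)) (at x)"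
    using pos by (auto intro!: derivative_eq_intros)
  from DERIV_mult[OF poly_DERIV this]
  have "(F has_real_derivative poly (pderiv p) x * (1 + x\<^sup>2) powr e +
      e * (1 + x\<^sup>2) powr (e - 1) * (2 * x) * poly p x) (at x)"
    unfolding F .
  also have "poly (pderiv p) x * (1 + x\<^sup>2) powr e +
      e * (1 + x\<^sup>2) powr (e - 1) * (2 * x) * poly p x =
      poly (angular_deriv k p) x * (1 + x\<^sup>2) powr (e - 1)"
    unfolding split poly_angular_deriv by (simp add: e_def algebra_simps)
  finally show "(F has_real_derivative
      poly (angular_deriv k p) x * (1 + x\<^sup>2) powr (- real (k + 2) / 2)) (at x)"
    unfolding e' .
qed

lemma powr_mult_eq_iff:
  fixes x y z :: real
  shows "y = (1 + x\<^sup>2) powr (real k / 2) * z \<longleftrightarrow> z = y * (1 + x\<^sup>2) powr (- real k / 2)"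
proof -
  have "1 + x\<^sup>2 > 0"
    by (simp add: add_pos_nonneg)
  then show ?thesis
    by (auto simp: powr_minus field_simps)
qed

text \<open>
  The recursion depends only on the exponent of the weight and not on the function that is differentiated,
  so that both families can share it.
\<close>
lemma poly_of_derivative_Suc:
  assumes R: "\<And>L x. poly (R L) x = (1 + x\<^sup>2) powr (real (2 * L + 3) / 2) * (deriv ^^ L) F x"
  shows "R (Suc L) = angular_deriv (2 * L + 3) (R L)"
proof -
  have D: "(deriv ^^ L) F x = poly (R L) x * (1 + x\<^sup>2) powr (- real (2 * L + 3) / 2)" for L x
    using R[of L x] powr_mult_eq_iff by blast
  have "(deriv ^^ Suc L) F x =
      poly (angular_deriv (2 * L + 3) (R L)) x * (1 + x\<^sup>2) powr (- real (2 * L + 3 + 2) / 2)" for x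
    using deriv_poly_times_powr[of "(deriv ^^ L) F" "R L" "2 * L + 3" x] D by simp
  moreover have "2 * L + 3 + 2 = 2 * Suc L + 3"
    by simp
  ultimately have "poly (angular_deriv (2 * L + 3) (R L)) x = poly (R (Suc L)) x" for x
    unfolding R powr_mult_eq_iff by metis
  then show ?thesis
    by (simp add: poly_eq_poly_eq_iff[symmetric] fun_eq_iff)
qed

lemma P_poly_Suc: "P_poly (Suc L) = angular_deriv (2 * L + 3) (P_poly L)"
  by (rule poly_of_derivative_Suc) (simp only: poly_P_poly A_fun_def)

lemma Q_poly_Suc: "Q_poly (Suc L) = angular_deriv (2 * L + 3) (Q_poly L)"
  by (rule poly_of_derivative_Suc) (simp only: poly_Q_poly B_fun_def)

lemma P_poly_0: "P_poly 0 = [:0, 1:]"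
proof -
  have "poly [:0, 1:] x = poly (P_poly 0) x" for x
    using powr_mult_eq_iff[of x x 3 "A_fun 0 x"]
    by (simp add: poly_P_poly A_fun_def powr_minus_divide add.commute)
  then show ?thesis
    by (simp add: poly_eq_poly_eq_iff[symmetric] fun_eq_iff)
qed

lemma Q_poly_0: "Q_poly 0 = 1"
proof -
  have "poly 1 x = poly (Q_poly 0) x" for x
    using powr_mult_eq_iff[of 1 x 3 "B_fun 0 x"]
    by (simp add: poly_Q_poly B_fun_def powr_minus_divide add.commute)
  then show ?thesis
    by (simp add: poly_eq_poly_eq_iff[symmetric] fun_eq_iff)
qed

lemma splits_simply_P_poly: "splits_simply (P_poly L) \<and> degree (P_poly L) = L + 1"
proof (induction L)
  case 0
  have "{x::real. poly [:0, 1:] x = 0} = {0}"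
    by auto
  then show ?case
    by (simp add: P_poly_0 splits_simply_def)
next
  case (Suc L)
  then show ?case
    using angular_deriv_interlaces(1)[of "P_poly L" "2 * L + 3"]
      degree_angular_deriv[of "P_poly L" "2 * L + 3"]
    by (simp add: P_poly_Suc splits_simply_def)
qed

lemma splits_simply_Q_poly: "splits_simply (Q_poly L) \<and> degree (Q_poly L) = L"
proof (induction L)
  case 0
  show ?case
    by (simp add: Q_poly_0 splits_simply_def)
next
  case (Suc L)
  then show ?case
    using angular_deriv_interlaces(1)[of "Q_poly L" "2 * L + 3"]
      degree_angular_deriv[of "Q_poly L" "2 * L + 3"]
    by (simp add: Q_poly_Suc splits_simply_def)
qed

theorem proposition4p4:
  fixes L :: nat
  assumes "L \<ge> 1"
  shows "(degree (P_poly L) = L + 1 \<and> card {x. poly (P_poly L) x = 0} = L + 1 \<and>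
          zeros_strictly_interlace (P_poly L) (P_poly (L - 1))) \<and>
         (degree (Q_poly L) = L \<and> card {x. poly (Q_poly L) x = 0} = L \<and>
          zeros_strictly_interlace (Q_poly L) (Q_poly (L - 1)))"
proof -
  obtain M where L: "L = Suc M"
    using assms by (cases L) auto
  have "zeros_strictly_interlace (P_poly L) (P_poly (L - 1))"
    using angular_deriv_interlaces(2)[of "P_poly M" "2 * M + 3"] splits_simply_P_poly[of M]
    by (simp add: L P_poly_Suc)
  moreover have "zeros_strictly_interlace (Q_poly L) (Q_poly (L - 1))"
    using angular_deriv_interlaces(2)[of "Q_poly M" "2 * M + 3"] splits_simply_Q_poly[of M]
    by (simp add: L Q_poly_Suc)
  ultimately show ?thesis
    using splits_simply_P_poly[of L] splits_simply_Q_poly[of L]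
    by (simp add: splits_simply_def)
qed

end
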